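(* Consider real monic hyperbolic polynomials of degree $6$ with all coefficients nonvanishing, with exactly two sign changes in the sequence of coefficients, and with six distinct moduli of roots. For each of the sign patterns $\Sigma_{m,n,q}$ listed below, the set of cases $(a,b,w)$ (with $a,b,w$ nonnegative integers, $a+b+w=4$) in which $\Sigma_{m,n,q}$ is realizable is exactly the following. 1. $\Sigma_{1,5,1}$ is realizable exactly in the case $(0,4,0)$. 2. For all integers $m,q\geq 1$ with $m+q=6$, $\Sigma_{m,1,q}$ is realizable exactly in the case $(q-1,0,m-1)$. 3. $\Sigma_{2,4,1}$ is realizable exactly in the cases $(0,2,2)$, $(0,3,1)$, $(0,4,0)$ (in particular it is not realizable in the cases $(0,0,4)$, $(0,1,3)$). 4. $\Sigma_{3,3,1}$ is realizable exactly in the cases $(1,0,3)$, $(0,0,4)$, $(0,1,3)$, $(0,2,2)$, $(0,3,1)$, $(0,4,0)$. 5. $\Sigma_{4,2,1}$ is realizable exactly in the cases $(1,0,3)$, $(0,0,4)$, $(0,1,3)$, $(0,2,2)$ (in particular it is not realizable in the cases $(0,3,1)$, $(0,4,0)$). 6. $\Sigma_{2,3,2}$ is realizable in all cases $(a,b,w)$ with $a+b+w=4$. 7. $\Sigma_{3,2,2}$ is realizable in all cases $(a,b,w)$ with $a+b+w=4$ except $(4,0,0)$, $(3,1,0)$, $(2,2,0)$, $(1,3,0)$, in which it is not realizable. The results for the remaining sign patterns $\Sigma_{m,n,q}$ with $m+n+q=7$, $m,n,q\geq 1$, follow by reversion: $\Sigma_{m,n,q}$ is realizable in the case $(a,b,w)$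 if and only if $\Sigma_{q,n,m}$ is realizable in the case $(w,b,a)$.
   Context: A real univariate polynomial is called hyperbolic if all its roots are real. For positive integers $m,n,q$ with $m+n+q=7$, $\Sigma_{m,n,q}$ denotes the sign pattern consisting of $m$ pluses followed by $n$ minuses followed by $q$ pluses. A polynomial $P=x^6+\sum_{j=0}^{5}a_jx^j$ with all $a_j\neq 0$ real defines the sign pattern $(+,\mathrm{sgn}(a_5),\ldots,\mathrm{sgn}(a_0))$. By Descartes' rule of signs, a degree $6$ hyperbolic polynomial with nonvanishing coefficients defining $\Sigma_{m,n,q}$ has exactly two positive and four negative roots, counted with multiplicity. Suppose that the six moduli of roots are distinct. Denote the positive roots by $0<\beta<\alpha$ and the moduli of the negative roots by $0<\gamma_1<\gamma_2<\gamma_3<\gamma_4$, and set $\gamma_0:=0$, $\gamma_5:=\infty$. For nonnegative integers $a,b,w$ with $a+b+w=4$, the polynomial realizes the case $(a,b,w)$ if $\gamma_a<\beta<\gamma_{a+1}$ and $\gamma_{a+b}<\alpha<\gamma_{a+b+1}$ (i.e. exactly $a$ of the $\gamma_i$ are smaller than $\beta$, exactly $b$ lie between $\beta$ and $\alpha$, and exactly $w$ are larger than $\alpha$). The sign pattern $\Sigma_{m,n,q}$ is realizable in the case $(a,b,w)$ if there exists a degree $6$ monic hyperbolic polynomial defining the sign pattern $\Sigma_{m,n,q}$, with distinct moduli of its roots, which realizes the case $(a,b,w)$. *)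

theory Defs
  imports "HOL-Computational_Algebra.Computational_Algebra" "HOL-Library.Extended_Real"
begin

definition complex_roots :: "real poly \<Rightarrow> complex set" where
  "complex_roots p = {z. poly (map_poly complex_of_real p) z = 0}"

definition hyperbolic :: "real poly \<Rightarrow> bool" where
  "hyperbolic p \<longleftrightarrow> complex_roots p \<subseteq> \<real>"

text \<open>The moduli of the roots, counted with multiplicity, are pairwise distinct iff
  there are as many different moduli as the degree; in particular all roots are then simple.\<close>

definition distinct_moduli :: "real poly \<Rightarrow> bool" where
  "distinct_moduli p \<longleftrightarrow> p \<noteq> 0 \<and> card (norm ` complex_roots p) = degree p"

text \<open>Signs are listed from the leading coefficient down to the constant term.\<close>

definition sign_pattern :: "real poly \<Rightarrow> real list" where
  "sign_pattern p = map sgn (rev (coeffs p))"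

definition Sigma_pattern :: "nat \<Rightarrow> nat \<Rightarrow> nat \<Rightarrow> real list" where
  "Sigma_pattern m n q = replicate m 1 @ replicate n (-1) @ replicate q 1"

definition positive_roots :: "real poly \<Rightarrow> real set" where
  "positive_roots p = {x. x > 0 \<and> poly p x = 0}"

definition negative_root_moduli :: "real poly \<Rightarrow> real set" where
  "negative_root_moduli p = {\<bar>x\<bar> |x. x < 0 \<and> poly p x = 0}"

text \<open>The sequence \<open>\<gamma>\<close> takes extended real values to accommodate \<open>\<gamma> 5 = \<infinity>\<close>;
  its values at indices above 5 are irrelevant.\<close>

definition realizes_case :: "real poly \<Rightarrow> nat \<times> nat \<times> nat \<Rightarrow> bool" where
  "realizes_case p = (\<lambda>(a, b, w). a + b + w = 4 \<and>
     (\<exists>(\<alpha>::real) (\<beta>::real) (\<gamma>::nat \<Rightarrow> ereal).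
        positive_roots p = {\<beta>, \<alpha>} \<and> 0 < \<beta> \<and> \<beta> < \<alpha> \<and>
        \<gamma> 0 = 0 \<and> \<gamma> 5 = \<infinity> \<and> strict_mono_on {0..5} \<gamma> \<and>
        \<gamma> ` {1..4} = ereal ` negative_root_moduli p \<and>
        \<gamma> a < ereal \<beta> \<and> ereal \<beta> < \<gamma> (a + 1) \<and>
        \<gamma> (a + b) < ereal \<alpha> \<and> ereal \<alpha> < \<gamma> (a + b + 1)))"

definition realizable :: "nat \<Rightarrow> nat \<Rightarrow> nat \<Rightarrow> nat \<times> nat \<times> nat \<Rightarrow> bool" where
  "realizable m n q c \<longleftrightarrow> (\<exists>p :: real poly.
     degree p = 6 \<and> lead_coeff p = 1 \<and> hyperbolic p \<and>
     (\<forall>j\<le>6. coeff p j \<noteq> 0) \<and> sign_pattern p = Sigma_pattern m n q \<and>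
     distinct_moduli p \<and> realizes_case p c)"

definition realizable_cases :: "nat \<Rightarrow> nat \<Rightarrow> nat \<Rightarrow> (nat \<times> nat \<times> nat) set" where
  "realizable_cases m n q = {c. realizable m n q c}"

end

theory Submission
  imports Defs "HOL-Complex_Analysis.Complex_Analysis"
begin

text \<open>
  Everything is read off from the six roots. If the negative roots are
  \<open>-g1 > -g2 > -g3 > -g4\<close> and the positive ones are \<open>\<beta> < \<alpha>\<close>, then the coefficient of
  \<open>x^(6-k)\<close> is \<open>e\<^sub>k - (\<alpha>+\<beta>) e\<^sub>k\<^sub>-\<^sub>1 + \<alpha>\<beta> e\<^sub>k\<^sub>-\<^sub>2\<close>, where the \<open>e\<^sub>i\<close> are the elementary symmetric
  functions of the \<open>g\<close>'s. A sign pattern is therefore realizable in a case iff six numbers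
  in the prescribed order give the six expressions the prescribed signs (\<open>realizableI\<close>,
  \<open>realizableE\<close>). For every realizable case six integers do it.

  The exclusions come from four estimates and one counting argument.

  \<^item> If the coefficient of \<open>x\<close> is negative, then \<open>1/g1 + 1/g2 + 1/g3 + 1/g4 < 1/\<beta> + 1/\<alpha>\<close>, so
    \<open>\<beta> > g1\<close> forces \<open>\<alpha> < g2\<close> (\<open>second_modulus_bound\<close>).
  \<^item> If the coefficients of \<open>x^4\<close> and \<open>x\<close> are negative, then \<open>\<alpha> > g2\<close>
    (\<open>above_second_modulus\<close>).
  \<^item> If the coefficient of \<open>x^3\<close> is positive and \<open>\<beta> < g1\<close>, then \<open>\<alpha> < g3\<close>
    (\<open>below_third_modulus\<close>).
  \<^item> If the coefficients of \<open>x^5\<close> and \<open>x^4\<close> are positive and \<open>\<beta> > g1\<close>, then \<open>\<alpha> < g4\<close>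
    (\<open>not_above_all_moduli\<close>).
  \<^item> If \<open>x^q\<close> is the only monomial with a negative coefficient, then at each radius
    \<open>r\<close> between \<open>\<beta>\<close> and \<open>\<alpha>\<close> the polynomial is negative, which says that this monomial
    dominates the sum of all others on the circle \<open>|z| = r\<close>. By Rouche's theorem exactly \<open>q\<close>
    roots have modulus less than \<open>r\<close>, for all these \<open>r\<close>. Hence no \<open>g\<close> lies between
    \<open>\<beta>\<close> and \<open>\<alpha>\<close>, and \<open>q - 1\<close> of them lie below \<open>\<beta>\<close> (\<open>one_negative_coeff\<close>).

  Inverting the roots reverses the coefficient sequence up to a positive factor, which gives the
  symmetry under reversion. This also settles \<open>\<Sigma>\<^sub>1\<^sub>,\<^sub>5\<^sub>,\<^sub>1\<close>: it is its own reversion, so the first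
  estimate applies at both ends of the root sequence and leaves only \<open>(0,4,0)\<close>. In general the first
  estimate restricts the patterns with \<open>q = 1\<close> to \<open>a = 0\<close> and the case \<open>(1,0,3)\<close>; the second
  removes \<open>w > 2\<close> from \<open>\<Sigma>\<^sub>2\<^sub>,\<^sub>4\<^sub>,\<^sub>1\<close>, the third removes \<open>w < 2\<close> from \<open>\<Sigma>\<^sub>4\<^sub>,\<^sub>2\<^sub>,\<^sub>1\<close>, and the fourth
  removes the cases with \<open>w = 0 < a\<close> from \<open>\<Sigma>\<^sub>3\<^sub>,\<^sub>2\<^sub>,\<^sub>2\<close>.
\<close>

section \<open>Counting roots in a disc with a dominant monomial\<close>

text \<open>Rouche's theorem, comparing with the dominant monomial \<open>b * z^k\<close>, whose only zero is at
  the origin. The roots in \<open>A\<close> are simple, so each of them inside the circle counts once.\<close>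

lemma card_roots_inside_circle:
  fixes A :: "complex set" and b :: complex and r :: real
  assumes "finite A" and "r > 0"
    and dominant: "\<And>z. norm z = r \<Longrightarrow> norm ((\<Prod>c\<in>A. z - c) - b * z ^ k) < norm (b * z ^ k)"
  shows "card {c\<in>A. norm c < r} = k"
proof -
  define f where "f = (\<lambda>z::complex. b * z ^ k)"
  define g where "g = (\<lambda>z. (\<Prod>c\<in>A. z - c) - b * z ^ k)"
  have fg: "f p + g p = (\<Prod>c\<in>A. p - c)" for p by (simp add: f_def g_def)
  have "b \<noteq> 0" using dominant[of "of_real r"] \<open>r > 0\<close> by auto
  have zeros_fg: "{p \<in> UNIV. f p + g p = 0} = A" using \<open>finite A\<close> by (auto simp: fg)
  have zeros_f: "{p \<in> UNIV. f p = 0} = (if k = 0 then {} else {0})"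
    using \<open>b \<noteq> 0\<close> by (auto simp: f_def)
  have zo_fg: "zorder (\<lambda>p. f p + g p) a = 1" if "a \<in> A" for a
    by (rule zorder_eqI[of UNIV _ "\<lambda>z. \<Prod>c\<in>A - {a}. z - c"])
      (use that \<open>finite A\<close> in \<open>auto simp: fg prod.remove[of A a] intro!: holomorphic_intros\<close>)
  have zo_f: "zorder f 0 = int k"
    by (rule zorder_eqI[of UNIV _ "\<lambda>z. b"])
      (use \<open>b \<noteq> 0\<close> in \<open>auto simp: f_def\<close>)
  have wind: "winding_number (circlepath 0 r) a = of_bool (norm a < r)" if "a \<in> A" for a
  proof (cases "norm a < r")
    case True
    then show ?thesis by (simp add: winding_number_circlepath)
  next
    case False
    moreover have "(\<Prod>c\<in>A. a - c) = 0"
      using that \<open>finite A\<close> by (intro prod_zero) auto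
    then have "norm a \<noteq> r"
      using dominant[of a] by auto
    ultimately have "winding_number (circlepath 0 r) a = 0"
      using \<open>r > 0\<close> by (intro winding_number_zero_outside[of _ "cball 0 r"]) (auto simp: sphere_def)
    then show ?thesis using False by simp
  qed
  have "(\<Sum>p\<in>{p \<in> UNIV. f p + g p = 0}. winding_number (circlepath 0 r) p * zorder (\<lambda>p. f p + g p) p)
      = (\<Sum>p\<in>{p \<in> UNIV. f p = 0}. winding_number (circlepath 0 r) p * zorder f p)"
    by (rule Rouche_theorem)
      (use \<open>finite A\<close> \<open>r > 0\<close> \<open>b \<noteq> 0\<close> dominant in \<open>auto simp: zeros_fg zeros_f f_def g_def intro!: holomorphic_intros\<close>)
  then have "(\<Sum>a\<in>A. of_bool (norm a < r)) = (of_nat k :: complex)"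
    unfolding zeros_fg zeros_f using \<open>r > 0\<close>
    by (simp add: zo_fg zo_f wind winding_number_circlepath_centre split: if_splits)
  then have "of_nat (card {c\<in>A. norm c < r}) = (of_nat k :: complex)"
    using \<open>finite A\<close> by (simp add: sum.If_cases of_bool_def Int_def)
  then show ?thesis by (simp only: of_nat_eq_iff)
qed

section \<open>Reduction to the six roots\<close>

definition admissible :: "real \<Rightarrow> real \<Rightarrow> real \<Rightarrow> real \<Rightarrow> real \<Rightarrow> real \<Rightarrow> bool" where
  "admissible g1 g2 g3 g4 \<beta> \<alpha> \<longleftrightarrow> 0 < g1 \<and> g1 < g2 \<and> g2 < g3 \<and> g3 < g4 \<and>
     0 < \<beta> \<and> \<beta> < \<alpha> \<and> \<beta> \<notin> {g1, g2, g3, g4} \<and> \<alpha> \<notin> {g1, g2, g3, g4}"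

text \<open>With the \<open>g\<^sub>i\<close> increasing, exactly \<open>k\<close> of them are smaller than a number \<open>x\<close> iff
  \<open>g\<^sub>i < x \<longleftrightarrow> i \<le> k\<close> for all \<open>i\<close>. For \<open>x = \<alpha>\<close> the number \<open>k = a + b\<close> is expressed
  through \<open>w\<close>, which makes the definition symmetric under reversion. Counting is avoided, so that
  a case can be evaluated on numbers and queried one inequality at a time.\<close>

definition in_case :: "real \<Rightarrow> real \<Rightarrow> real \<Rightarrow> real \<Rightarrow> real \<Rightarrow> real \<Rightarrow> nat \<Rightarrow> nat \<Rightarrow> nat \<Rightarrow> bool" where
  "in_case g1 g2 g3 g4 \<beta> \<alpha> a b w \<longleftrightarrow> a + b + w = 4 \<and>
    (g1 < \<beta> \<longleftrightarrow> 1 \<le> a) \<and> (g2 < \<beta> \<longleftrightarrow> 2 \<le> a) \<and> (g3 < \<beta> \<longleftrightarrow> 3 \<le> a) \<and> (g4 < \<beta> \<longleftrightarrow> 4 \<le> a) \<and>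
    (g1 < \<alpha> \<longleftrightarrow> w \<le> 3) \<and> (g2 < \<alpha> \<longleftrightarrow> w \<le> 2) \<and> (g3 < \<alpha> \<longleftrightarrow> w \<le> 1) \<and> (g4 < \<alpha> \<longleftrightarrow> w \<le> 0)"

text \<open>The coefficients of
  \<open>(x - \<alpha>) (x - \<beta>) (x + g1) (x + g2) (x + g3) (x + g4)\<close>, from the leading one down, as in a
  sign pattern: the entry with index \<open>k\<close> belongs to \<open>x^(6-k)\<close>.\<close>

definition descending_coeffs :: "real \<Rightarrow> real \<Rightarrow> real \<Rightarrow> real \<Rightarrow> real \<Rightarrow> real \<Rightarrow> real list" where
  "descending_coeffs g1 g2 g3 g4 \<beta> \<alpha> =
    [1,
     (g1+g2+g3+g4) - (\<alpha>+\<beta>),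
     (g1*g2+g1*g3+g1*g4+g2*g3+g2*g4+g3*g4) - (\<alpha>+\<beta>)*(g1+g2+g3+g4) + \<alpha>*\<beta>,
     (g1*g2*g3 + g1*g2*g4 + g1*g3*g4 + g2*g3*g4)
       - (\<alpha>+\<beta>)*(g1*g2+g1*g3+g1*g4+g2*g3+g2*g4+g3*g4) + \<alpha>*\<beta>*(g1+g2+g3+g4),
     g1*g2*g3*g4 - (\<alpha>+\<beta>)*(g1*g2*g3 + g1*g2*g4 + g1*g3*g4 + g2*g3*g4)
       + \<alpha>*\<beta>*(g1*g2+g1*g3+g1*g4+g2*g3+g2*g4+g3*g4),
     \<alpha>*\<beta>*(g1*g2*g3 + g1*g2*g4 + g1*g3*g4 + g2*g3*g4) - (\<alpha>+\<beta>)*(g1*g2*g3*g4),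
     \<alpha>*\<beta>*(g1*g2*g3*g4)]"

definition root_poly :: "real \<Rightarrow> real \<Rightarrow> real \<Rightarrow> real \<Rightarrow> real \<Rightarrow> real \<Rightarrow> real poly" where
  "root_poly g1 g2 g3 g4 \<beta> \<alpha> = Poly (rev (descending_coeffs g1 g2 g3 g4 \<beta> \<alpha>))"

lemma poly_of_real_root_poly:
  fixes x :: "'a::real_field"
  shows "poly (map_poly of_real (root_poly g1 g2 g3 g4 \<beta> \<alpha>)) x =
    (x - of_real \<alpha>) * (x - of_real \<beta>) *
    (x + of_real g1) * (x + of_real g2) * (x + of_real g3) * (x + of_real g4)"
  by (simp add: root_poly_def descending_coeffs_def map_poly_pCons algebra_simps)

lemma poly_root_poly:
  "poly (root_poly g1 g2 g3 g4 \<beta> \<alpha>) x = (x - \<alpha>) * (x - \<beta>) * (x + g1) * (x + g2) * (x + g3) * (x + g4)"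
  by (simp add: root_poly_def descending_coeffs_def algebra_simps)

lemma coeffs_root_poly: "coeffs (root_poly g1 g2 g3 g4 \<beta> \<alpha>) = rev (descending_coeffs g1 g2 g3 g4 \<beta> \<alpha>)"
  by (simp add: root_poly_def descending_coeffs_def)

lemma degree_root_poly: "degree (root_poly g1 g2 g3 g4 \<beta> \<alpha>) = 6"
  by (simp add: root_poly_def descending_coeffs_def)

lemma lead_coeff_root_poly: "lead_coeff (root_poly g1 g2 g3 g4 \<beta> \<alpha>) = 1"
  by (simp add: root_poly_def descending_coeffs_def)

text \<open>A prescribed sign pattern has entries \<open>1\<close> and \<open>-1\<close> only, so the nonvanishing of the
  coefficients comes for free, and so do hyperbolicity and distinct moduli from the explicit
  roots.\<close>

lemma realizableI:
  assumes adm: "admissible g1 g2 g3 g4 \<beta> \<alpha>"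
    and cas: "in_case g1 g2 g3 g4 \<beta> \<alpha> a b w"
    and signs: "map sgn (descending_coeffs g1 g2 g3 g4 \<beta> \<alpha>) = Sigma_pattern m n q"
  shows "realizable m n q (a, b, w)"
proof -
  define p where "p = root_poly g1 g2 g3 g4 \<beta> \<alpha>"
  note ord = adm[unfolded admissible_def]
  have deg: "degree p = 6" and lead: "lead_coeff p = 1"
    unfolding p_def by (rule degree_root_poly, rule lead_coeff_root_poly)
  have sign: "sign_pattern p = Sigma_pattern m n q"
    using signs by (simp add: sign_pattern_def p_def coeffs_root_poly)
  have nonzero: "coeff p j \<noteq> 0" if "j \<le> 6" for j
  proof -
    have "coeff p j \<in> set (coeffs p)"
      using that deg lead by (auto simp: coeffs_def)
    then have "sgn (coeff p j) \<in> set (sign_pattern p)"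
      by (simp add: sign_pattern_def)
    then show ?thesis by (auto simp: sign Sigma_pattern_def)
  qed
  have roots: "complex_roots p =
      {of_real \<alpha>, of_real \<beta>, - of_real g1, - of_real g2, - of_real g3, - of_real g4}"
    by (auto simp: complex_roots_def p_def poly_of_real_root_poly add_eq_0_iff2)
  have "hyperbolic p" by (simp add: hyperbolic_def roots)
  have gt0: "g1 > 0" "g2 > 0" "g3 > 0" "g4 > 0" "\<beta> > 0" "\<alpha> > 0"
    using ord by auto
  have "norm ` complex_roots p = {\<alpha>, \<beta>, g1, g2, g3, g4}"
    unfolding roots using gt0 by (simp add: abs_of_pos)
  then have "distinct_moduli p"
    using ord deg by (auto simp: distinct_moduli_def)
  have pos: "positive_roots p = {\<beta>, \<alpha>}"
    using ord by (auto simp: positive_roots_def p_def poly_root_poly)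
  have neg: "negative_root_moduli p = {g1, g2, g3, g4}"
  proof -
    have "{x. x < 0 \<and> poly p x = 0} = {-g1, -g2, -g3, -g4}"
      using ord by (auto simp: p_def poly_root_poly add_eq_0_iff2)
    then have "negative_root_moduli p = abs ` {-g1, -g2, -g3, -g4}"
      unfolding negative_root_moduli_def by blast
    then show ?thesis using gt0 by (simp add: abs_of_pos)
  qed
  define \<gamma> where "\<gamma> = (\<lambda>i::nat. [0, ereal g1, ereal g2, ereal g3, ereal g4, \<infinity>] ! i)"
  have \<gamma>: "\<gamma> 0 = 0" "\<gamma> 1 = ereal g1" "\<gamma> 2 = ereal g2" "\<gamma> 3 = ereal g3" "\<gamma> 4 = ereal g4" "\<gamma> 5 = \<infinity>"
    "\<gamma> (Suc 0) = ereal g1"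
    by (simp_all add: \<gamma>_def)
  have range: "{0..5} = {0, 1, 2, 3, 4, 5::nat}" "{1..4} = {1, 2, 3, 4::nat}" by auto
  have mono: "strict_mono_on {0..5} \<gamma>"
    unfolding range strict_mono_on_def using ord by (auto simp: \<gamma>)
  have img: "\<gamma> ` {1..4} = ereal ` negative_root_moduli p"
    unfolding range neg by (simp add: \<gamma>)
  have D: "a + b + w = 4" "g1 < \<beta> \<longleftrightarrow> 1 \<le> a" "g2 < \<beta> \<longleftrightarrow> 2 \<le> a" "g3 < \<beta> \<longleftrightarrow> 3 \<le> a" "g4 < \<beta> \<longleftrightarrow> 4 \<le> a"
    "g1 < \<alpha> \<longleftrightarrow> w \<le> 3" "g2 < \<alpha> \<longleftrightarrow> w \<le> 2" "g3 < \<alpha> \<longleftrightarrow> w \<le> 1" "g4 < \<alpha> \<longleftrightarrow> w \<le> 0"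
    using cas by (simp_all only: in_case_def)
  have swap: "x < y \<longleftrightarrow> \<not> y < x" if "y \<noteq> x" for x y :: real
    using that by auto
  have D': "\<beta> < g1 \<longleftrightarrow> \<not> 1 \<le> a" "\<beta> < g2 \<longleftrightarrow> \<not> 2 \<le> a" "\<beta> < g3 \<longleftrightarrow> \<not> 3 \<le> a" "\<beta> < g4 \<longleftrightarrow> \<not> 4 \<le> a"
    "\<alpha> < g1 \<longleftrightarrow> \<not> w \<le> 3" "\<alpha> < g2 \<longleftrightarrow> \<not> w \<le> 2" "\<alpha> < g3 \<longleftrightarrow> \<not> w \<le> 1" "\<alpha> < g4 \<longleftrightarrow> \<not> w \<le> 0"
    unfolding D(2-)[symmetric] by (rule swap; use ord in blast)+
  consider "a = 0" | "a = 1" | "a = 2" | "a = 3" | "a = 4" using D(1) by linarith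
  then have loc_\<beta>: "\<gamma> a < ereal \<beta> \<and> ereal \<beta> < \<gamma> (a + 1)"
    by cases (use gt0 D D' in \<open>simp_all add: \<gamma>_def\<close>)
  consider "a + b = 0" "w = 4" | "a + b = 1" "w = 3" | "a + b = 2" "w = 2" | "a + b = 3" "w = 1"
    | "a + b = 4" "w = 0" using D(1) by linarith
  then have loc_\<alpha>: "\<gamma> (a + b) < ereal \<alpha> \<and> ereal \<alpha> < \<gamma> (a + b + 1)"
    by cases (use gt0 D(2-) D' in \<open>simp_all only: \<gamma>_def, simp_all\<close>)
  have "realizes_case p (a, b, w)"
    unfolding realizes_case_def prod.case
    using D(1) loc_\<beta> loc_\<alpha> pos img mono \<gamma> ord by blast
  then show ?thesis
    unfolding realizable_def using deg lead \<open>hyperbolic p\<close> nonzero sign \<open>distinct_moduli p\<close> by blast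
qed

text \<open>The two positive roots and the negatives of the four moduli are six roots of a monic polynomial
  of degree 6, which is therefore the product of the corresponding linear factors.\<close>

lemma realizableE:
  assumes "realizable m n q (a, b, w)"
  obtains g1 g2 g3 g4 \<beta> \<alpha> where "admissible g1 g2 g3 g4 \<beta> \<alpha>"
    and "in_case g1 g2 g3 g4 \<beta> \<alpha> a b w"
    and "map sgn (descending_coeffs g1 g2 g3 g4 \<beta> \<alpha>) = Sigma_pattern m n q"
proof -
  obtain p where deg: "degree p = 6" and lead: "lead_coeff p = 1"
    and sign: "sign_pattern p = Sigma_pattern m n q" and "realizes_case p (a, b, w)"
    using assms unfolding realizable_def by blast
  then obtain \<alpha> \<beta> \<gamma> where abw4: "a + b + w = 4"
    and pos: "positive_roots p = {\<beta>, \<alpha>}" "0 < \<beta>" "\<beta> < \<alpha>"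
    and \<gamma>: "\<gamma> 0 = 0" "\<gamma> 5 = \<infinity>" "strict_mono_on {0..5} \<gamma>"
    and img: "\<gamma> ` {1..4} = ereal ` negative_root_moduli p"
    and loc: "\<gamma> a < ereal \<beta>" "ereal \<beta> < \<gamma> (a + 1)" "\<gamma> (a + b) < ereal \<alpha>" "ereal \<alpha> < \<gamma> (a + b + 1)"
    unfolding realizes_case_def by auto
  have mono: "\<gamma> i < \<gamma> j" if "i < j" "j \<le> 5" for i j
    using strict_mono_onD[OF \<gamma>(3)] that by simp
  have mono': "\<gamma> i \<le> \<gamma> j" if "i \<le> j" "j \<le> 5" for i j
    using mono[of i j] that by (cases "i = j") auto
  define g where "g = (\<lambda>i. real_of_ereal (\<gamma> i))"
  have g: "\<gamma> i = ereal (g i)" "poly p (- g i) = 0" if "i \<in> {1..4}" for i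
  proof -
    have "\<gamma> i \<in> ereal ` negative_root_moduli p" using img that by blast
    then obtain x where "\<gamma> i = ereal \<bar>x\<bar>" "x < 0" "poly p x = 0"
      by (auto simp: negative_root_moduli_def)
    then show "\<gamma> i = ereal (g i)" "poly p (- g i) = 0" by (auto simp: g_def)
  qed
  have below_\<beta>: "if i \<le> a then g i < \<beta> else \<beta> < g i" if "i \<in> {1..4}" for i
  proof (cases "i \<le> a")
    case True
    then have "\<gamma> i < ereal \<beta>" using mono'[of i a] loc(1) abw4 by fastforce
    then show ?thesis using True g(1)[OF that] by simp
  next
    case False
    then have "ereal \<beta> < \<gamma> i" using mono'[of "a + 1" i] loc(2) that by fastforce
    then show ?thesis using False g(1)[OF that] by simp
  qed
  have below_\<alpha>: "if i \<le> a + b then g i < \<alpha> else \<alpha> < g i" if "i \<in> {1..4}" for i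
  proof (cases "i \<le> a + b")
    case True
    then have "\<gamma> i < ereal \<alpha>" using mono'[of i "a + b"] loc(3) abw4 by fastforce
    then show ?thesis using True g(1)[OF that] by simp
  next
    case False
    then have "ereal \<alpha> < \<gamma> i" using mono'[of "a + b + 1" i] loc(4) that by fastforce
    then show ?thesis using False g(1)[OF that] by simp
  qed
  have incr: "0 < g 1" "g 1 < g 2" "g 2 < g 3" "g 3 < g 4"
    using mono[of 0 1] mono[of 1 2] mono[of 2 3] mono[of 3 4] g(1)[of 1] g(1)[of 2] g(1)[of 3] g(1)[of 4] \<gamma>
    by simp_all
  have adm: "admissible (g 1) (g 2) (g 3) (g 4) \<beta> \<alpha>"
    unfolding admissible_def using incr pos below_\<beta>[of 1] below_\<beta>[of 2] below_\<beta>[of 3] below_\<beta>[of 4]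
      below_\<alpha>[of 1] below_\<alpha>[of 2] below_\<alpha>[of 3] below_\<alpha>[of 4] by (auto split: if_splits)
  have lt: "g i < \<beta> \<longleftrightarrow> i \<le> a" "\<beta> < g i \<longleftrightarrow> \<not> i \<le> a" "g i < \<alpha> \<longleftrightarrow> i \<le> a + b" "\<alpha> < g i \<longleftrightarrow> \<not> i \<le> a + b"
    if "i \<in> {1..4}" for i
    using below_\<beta>[OF that] below_\<alpha>[OF that] by (auto split: if_splits)
  have cas: "in_case (g 1) (g 2) (g 3) (g 4) \<beta> \<alpha> a b w"
    unfolding in_case_def using abw4 by (auto simp: lt)
  define A where "A = {\<alpha>, \<beta>, - g 1, - g 2, - g 3, - g 4}"
  have "card A = 6" unfolding A_def using incr pos by simp
  have "poly p \<beta> = 0" "poly p \<alpha> = 0" using pos(1) by (auto simp: positive_roots_def)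
  then have "p = root_poly (g 1) (g 2) (g 3) (g 4) \<beta> \<alpha>"
    using g(2) deg lead \<open>card A = 6\<close> degree_root_poly lead_coeff_root_poly[of "g 1" "g 2" "g 3" "g 4" \<beta> \<alpha>]
    by (intro poly_eqI_degree_lead_coeff[where A = A and n = 6]) (auto simp: A_def poly_root_poly)
  then have "map sgn (descending_coeffs (g 1) (g 2) (g 3) (g 4) \<beta> \<alpha>) = Sigma_pattern m n q"
    using sign by (simp add: sign_pattern_def coeffs_root_poly)
  with adm cas show thesis by (rule that)
qed

lemma descending_coeffs_sign:
  assumes "map sgn (descending_coeffs g1 g2 g3 g4 \<beta> \<alpha>) = Sigma_pattern m n q" and "k < 7"
  shows "k < m \<Longrightarrow> 0 < descending_coeffs g1 g2 g3 g4 \<beta> \<alpha> ! k"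
    and "m \<le> k \<Longrightarrow> k < m + n \<Longrightarrow> descending_coeffs g1 g2 g3 g4 \<beta> \<alpha> ! k < 0"
proof -
  have "m + n + q = 7"
    using arg_cong[OF assms(1), of length] by (simp add: descending_coeffs_def Sigma_pattern_def)
  moreover have "sgn (descending_coeffs g1 g2 g3 g4 \<beta> \<alpha> ! k) = Sigma_pattern m n q ! k"
    unfolding assms(1)[symmetric] using \<open>k < 7\<close>
    by (subst nth_map) (auto simp: descending_coeffs_def)
  ultimately have s: "sgn (descending_coeffs g1 g2 g3 g4 \<beta> \<alpha> ! k) =
      (if k < m then 1 else if k < m + n then -1 else 1)"
    using \<open>k < 7\<close> by (auto simp: Sigma_pattern_def nth_append)
  show "0 < descending_coeffs g1 g2 g3 g4 \<beta> \<alpha> ! k" if "k < m"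
  proof -
    have "sgn (descending_coeffs g1 g2 g3 g4 \<beta> \<alpha> ! k) = 1" using s that by (simp only: if_True)
    then show ?thesis by (simp only: sgn_1_pos)
  qed
  show "descending_coeffs g1 g2 g3 g4 \<beta> \<alpha> ! k < 0" if "m \<le> k" "k < m + n"
  proof -
    have "\<not> k < m" using that by simp
    then have "sgn (descending_coeffs g1 g2 g3 g4 \<beta> \<alpha> ! k) = -1"
      using s that by (simp only: if_True if_False)
    then show ?thesis by (simp only: sgn_1_neg)
  qed
qed

lemma nth_descending_coeffs:
  shows "descending_coeffs g1 g2 g3 g4 \<beta> \<alpha> ! 1 = (g1+g2+g3+g4) - (\<alpha>+\<beta>)" (is ?g1)
    and "descending_coeffs g1 g2 g3 g4 \<beta> \<alpha> ! 2 =
    (g1*g2+g1*g3+g1*g4+g2*g3+g2*g4+g3*g4) - (\<alpha>+\<beta>)*(g1+g2+g3+g4) + \<alpha>*\<beta>" (is ?g2)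
    and "descending_coeffs g1 g2 g3 g4 \<beta> \<alpha> ! 3 =
    (g1*g2*g3 + g1*g2*g4 + g1*g3*g4 + g2*g3*g4)
      - (\<alpha>+\<beta>)*(g1*g2+g1*g3+g1*g4+g2*g3+g2*g4+g3*g4) + \<alpha>*\<beta>*(g1+g2+g3+g4)" (is ?g3)
    and "descending_coeffs g1 g2 g3 g4 \<beta> \<alpha> ! 5 =
    \<alpha>*\<beta>*(g1*g2*g3 + g1*g2*g4 + g1*g3*g4 + g2*g3*g4) - (\<alpha>+\<beta>)*(g1*g2*g3*g4)" (is ?g5)
proof -
  have nth: "[x0, x1, x2, x3, x4, x5, x6] ! 1 = x1" "[x0, x1, x2, x3, x4, x5, x6] ! 2 = x2"
    "[x0, x1, x2, x3, x4, x5, x6] ! 3 = x3" "[x0, x1, x2, x3, x4, x5, x6] ! 5 = x5"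
    for x0 x1 x2 x3 x4 x5 x6 :: real
    by simp_all
  show ?g1 ?g2 ?g3 ?g5
    unfolding descending_coeffs_def nth by (rule refl)+
qed

section \<open>Reversion\<close>

lemma rev_Sigma_pattern: "rev (Sigma_pattern m n q) = Sigma_pattern q n m"
  by (simp add: Sigma_pattern_def)

text \<open>The elementary symmetric functions of the inverses of six numbers are those of the numbers in
  reverse order, divided by their product; here the product is positive, so signs persist.\<close>

lemma descending_coeffs_inverse:
  assumes "g1 > 0" "g2 > 0" "g3 > 0" "g4 > 0" "\<beta> > 0" "\<alpha> > 0"
  shows "descending_coeffs (1/g4) (1/g3) (1/g2) (1/g1) (1/\<alpha>) (1/\<beta>) =
    map (\<lambda>x. x / (\<alpha> * \<beta> * (g1*g2*g3*g4))) (rev (descending_coeffs g1 g2 g3 g4 \<beta> \<alpha>))"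
  using assms by (simp add: descending_coeffs_def divide_simps) (simp add: algebra_simps)

lemma realizable_reversion:
  assumes "realizable m n q (a, b, w)"
  shows "realizable q n m (w, b, a)"
proof -
  obtain g1 g2 g3 g4 \<beta> \<alpha> where adm: "admissible g1 g2 g3 g4 \<beta> \<alpha>"
    and cas: "in_case g1 g2 g3 g4 \<beta> \<alpha> a b w"
    and signs: "map sgn (descending_coeffs g1 g2 g3 g4 \<beta> \<alpha>) = Sigma_pattern m n q"
    using realizableE[OF assms] by blast
  have pos: "g1 > 0" "g2 > 0" "g3 > 0" "g4 > 0" "\<beta> > 0" "\<alpha> > 0"
    using adm by (auto simp: admissible_def)
  have inv_less: "1 / x < 1 / y \<longleftrightarrow> y < x" if "x > 0" "y > 0" for x y :: real
    using that by (simp add: field_simps)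
  show ?thesis
  proof (rule realizableI)
    show "admissible (1/g4) (1/g3) (1/g2) (1/g1) (1/\<alpha>) (1/\<beta>)"
      using adm pos by (auto simp: admissible_def inv_less)
    have swap: "x < y \<longleftrightarrow> \<not> y < x" if "y \<noteq> x" for x y :: real
      using that by auto
    have G: "\<beta> < g1 \<longleftrightarrow> \<not> g1 < \<beta>" "\<beta> < g2 \<longleftrightarrow> \<not> g2 < \<beta>" "\<beta> < g3 \<longleftrightarrow> \<not> g3 < \<beta>" "\<beta> < g4 \<longleftrightarrow> \<not> g4 < \<beta>"
      "\<alpha> < g1 \<longleftrightarrow> \<not> g1 < \<alpha>" "\<alpha> < g2 \<longleftrightarrow> \<not> g2 < \<alpha>" "\<alpha> < g3 \<longleftrightarrow> \<not> g3 < \<alpha>" "\<alpha> < g4 \<longleftrightarrow> \<not> g4 < \<alpha>"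
      by (rule swap; use adm in \<open>unfold admissible_def, blast\<close>)+
    have F: "a + b + w = 4" "g1 < \<beta> \<longleftrightarrow> 1 \<le> a" "g2 < \<beta> \<longleftrightarrow> 2 \<le> a" "g3 < \<beta> \<longleftrightarrow> 3 \<le> a" "g4 < \<beta> \<longleftrightarrow> 4 \<le> a"
      "g1 < \<alpha> \<longleftrightarrow> w \<le> 3" "g2 < \<alpha> \<longleftrightarrow> w \<le> 2" "g3 < \<alpha> \<longleftrightarrow> w \<le> 1" "g4 < \<alpha> \<longleftrightarrow> w \<le> 0"
      using cas by (simp_all only: in_case_def)
    show "in_case (1/g4) (1/g3) (1/g2) (1/g1) (1/\<alpha>) (1/\<beta>) w b a"
      unfolding in_case_def inv_less[OF pos(4,6)] inv_less[OF pos(3,6)] inv_less[OF pos(2,6)]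
        inv_less[OF pos(1,6)] inv_less[OF pos(4,5)] inv_less[OF pos(3,5)] inv_less[OF pos(2,5)]
        inv_less[OF pos(1,5)] G F(2-)
      using F(1) by auto
    have "sgn (x / (\<alpha> * \<beta> * (g1*g2*g3*g4))) = sgn x" for x
      using pos by (simp add: sgn_divide sgn_mult)
    then have "map sgn (descending_coeffs (1/g4) (1/g3) (1/g2) (1/g1) (1/\<alpha>) (1/\<beta>)) =
        rev (map sgn (descending_coeffs g1 g2 g3 g4 \<beta> \<alpha>))"
      by (simp add: descending_coeffs_inverse[OF pos] rev_map)
    then show "map sgn (descending_coeffs (1/g4) (1/g3) (1/g2) (1/g1) (1/\<alpha>) (1/\<beta>)) = Sigma_pattern q n m"
      by (simp only: signs rev_Sigma_pattern)
  qed
qed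

section \<open>A single negative coefficient\<close>

text \<open>Since all coefficients but that of \<open>x^q\<close> are positive, the absolute values of the other
  terms on the circle of radius \<open>r\<close> add up to \<open>p(r) - c\<^sub>q r^q\<close>, and \<open>p(r) < 0\<close> for
  \<open>\<beta> < r < \<alpha>\<close> says precisely that this is less than \<open>\<bar>c\<^sub>q\<bar> r^q\<close>. So the monomial \<open>x^q\<close> dominates on
  all these circles: there are no roots on them, and \<open>q\<close> roots inside, one of which is \<open>\<beta>\<close>.\<close>

lemma one_negative_coeff:
  assumes adm: "admissible g1 g2 g3 g4 \<beta> \<alpha>"
    and cas: "in_case g1 g2 g3 g4 \<beta> \<alpha> a b w"
    and signs: "map sgn (descending_coeffs g1 g2 g3 g4 \<beta> \<alpha>) = Sigma_pattern m 1 q"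
  shows "a + 1 = q \<and> b = 0"
proof -
  note ord = adm[unfolded admissible_def]
  define p where "p = root_poly g1 g2 g3 g4 \<beta> \<alpha>"
  define B where "B = {\<alpha>, \<beta>, - g1, - g2, - g3, - g4}"
  define A :: "complex set" where "A = of_real ` B"
  have "finite B" by (simp add: B_def)
  have distinct: "\<alpha> \<notin> {\<beta>, - g1, - g2, - g3, - g4}" "\<beta> \<notin> {- g1, - g2, - g3, - g4}"
    "- g1 \<notin> {- g2, - g3, - g4}" "- g2 \<notin> {- g3, - g4}" "- g3 \<notin> {- g4}"
    using ord by auto
  have deg: "degree p = 6" by (simp add: p_def degree_root_poly)
  have len: "m + q = 6"
    using arg_cong[OF signs, of length] by (simp add: descending_coeffs_def Sigma_pattern_def)
  have sgn_coeff: "sgn (coeff p j) = (if j = q then -1 else 1)" if "j \<le> 6" for j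
  proof -
    have "sgn (coeff p j) = map sgn (rev (descending_coeffs g1 g2 g3 g4 \<beta> \<alpha>)) ! j"
    proof -
      have "p \<noteq> 0" using deg by auto
      then have "coeff p j = rev (descending_coeffs g1 g2 g3 g4 \<beta> \<alpha>) ! j"
        using coeffs_nth[of p j] that deg by (simp add: p_def coeffs_root_poly)
      then show ?thesis
        using that by (subst nth_map) (auto simp: descending_coeffs_def)
    qed
    also have "\<dots> = Sigma_pattern q 1 m ! j"
      by (simp only: rev_map[symmetric] signs rev_Sigma_pattern)
    also have "\<dots> = (if j = q then -1 else 1)"
      using that len by (auto simp: Sigma_pattern_def nth_append)
    finally show ?thesis .
  qed
  have neg: "coeff p q < 0"
  proof -
    have "sgn (coeff p q) = -1" using sgn_coeff[of q] len by simp
    then show ?thesis by (simp only: sgn_1_neg)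
  qed
  have pos: "coeff p j > 0" if "j \<le> 6" "j \<noteq> q" for j
  proof -
    have "sgn (coeff p j) = 1" using sgn_coeff[of j] that by simp
    then show ?thesis by (simp only: sgn_1_pos)
  qed
  have prod_A: "(\<Prod>c\<in>A. z - c) = poly (map_poly of_real p) z" for z
  proof -
    have "(\<Prod>c\<in>A. z - c) = (\<Prod>x\<in>B. z - of_real x)"
      unfolding A_def by (subst prod.reindex) (auto simp: inj_on_def)
    also have "\<dots> = (z - of_real \<alpha>) * (z - of_real \<beta>) * (z + of_real g1) * (z + of_real g2) *
        (z + of_real g3) * (z + of_real g4)"
      unfolding B_def using distinct by (simp add: mult.assoc)
    finally show ?thesis by (simp only: p_def poly_of_real_root_poly)
  qed
  have dominant: "norm ((\<Prod>c\<in>A. z - c) - of_real (coeff p q) * z ^ q) < norm (of_real (coeff p q) * z ^ q)"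
    if "\<beta> < norm z" "norm z < \<alpha>" for z
  proof -
    define r where "r = norm z"
    have q: "{..6} = insert q ({..6} - {q})" using len by auto
    have "poly (map_poly of_real p) z = (\<Sum>j\<le>6. of_real (coeff p j) * z ^ j)"
      by (simp add: poly_altdef deg coeff_map_poly degree_map_poly)
    also have "\<dots> = of_real (coeff p q) * z ^ q + (\<Sum>j\<in>{..6} - {q}. of_real (coeff p j) * z ^ j)"
      by (subst q, subst sum.insert) auto
    finally have "norm ((\<Prod>c\<in>A. z - c) - of_real (coeff p q) * z ^ q)
        \<le> (\<Sum>j\<in>{..6} - {q}. norm (of_real (coeff p j) * z ^ j))"
      by (simp add: prod_A norm_sum)
    also have "\<dots> = (\<Sum>j\<in>{..6} - {q}. coeff p j * r ^ j)"
      using pos by (intro sum.cong) (auto simp: norm_mult norm_power r_def abs_of_pos)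
    also have "\<dots> = poly p r - coeff p q * r ^ q"
      by (simp only: poly_altdef deg, subst (2) q, subst sum.insert) auto
    also have "\<dots> < - coeff p q * r ^ q"
    proof -
      have "(r - \<alpha>) * (r - \<beta>) < 0" and "0 < (r + g1) * (r + g2) * (r + g3) * (r + g4)"
        using that ord by (auto simp: r_def intro!: mult_neg_pos mult_pos_pos add_pos_pos)
      then have "(r - \<alpha>) * (r - \<beta>) * ((r + g1) * (r + g2) * (r + g3) * (r + g4)) < 0"
        by (rule mult_neg_pos)
      then show ?thesis by (simp add: p_def poly_root_poly mult.assoc)
    qed
    also have "\<dots> = norm (of_real (coeff p q) * z ^ q)"
      using neg by (simp add: norm_mult norm_power r_def)
    finally show ?thesis .
  qed
  have none_between: "\<not> (\<beta> < g \<and> g < \<alpha>)" if "- g \<in> B" "0 < g" for g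
  proof
    assume "\<beta> < g \<and> g < \<alpha>"
    moreover have "(\<Prod>c\<in>A. - of_real g - c) = 0"
      using that \<open>finite B\<close> by (intro prod_zero) (auto simp: A_def intro!: bexI[of _ "- g"])
    ultimately show False using dominant[of "- of_real g"] \<open>0 < g\<close> by simp
  qed
  define r where "r = (\<beta> + \<alpha>) / 2"
  have r: "\<beta> < r" "r < \<alpha>" "0 < r" using ord by (auto simp: r_def)
  have "card {c \<in> A. norm c < r} = q"
    by (rule card_roots_inside_circle) (use r dominant \<open>finite B\<close> in \<open>auto simp: A_def\<close>)
  also have "{c \<in> A. norm c < r} = of_real ` {x \<in> B. \<bar>x\<bar> < r}"
    by (auto simp: A_def)
  also have "card (of_real ` {x \<in> B. \<bar>x\<bar> < r} :: complex set) = card {x \<in> B. \<bar>x\<bar> < r}"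
    by (intro card_image) (auto simp: inj_on_def)
  also have "\<dots> = (\<Sum>x\<in>B. of_bool (\<bar>x\<bar> < r))"
    using \<open>finite B\<close> by (simp add: sum.If_cases of_bool_def Int_def)
  also have "\<dots> = 1 + of_bool (g1 < r) + of_bool (g2 < r) + of_bool (g3 < r) + of_bool (g4 < r)"
    unfolding B_def using distinct ord r by (simp add: abs_of_pos)
  finally have count: "q = 1 + of_bool (g1 < r) + of_bool (g2 < r) + of_bool (g3 < r) + of_bool (g4 < r)" ..
  have cmp: "(g < r \<longleftrightarrow> g < \<beta>) \<and> (g < \<beta> \<longleftrightarrow> g < \<alpha>)" if "- g \<in> B" "0 < g" "g \<noteq> \<beta>" for g
    using none_between[OF that(1,2)] that(3) r by linarith
  have "- g1 \<in> B" "- g2 \<in> B" "- g3 \<in> B" "- g4 \<in> B" by (simp_all add: B_def)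
  moreover have "0 < g1" "0 < g2" "0 < g3" "0 < g4" "g1 \<noteq> \<beta>" "g2 \<noteq> \<beta>" "g3 \<noteq> \<beta>" "g4 \<noteq> \<beta>"
    using ord by auto
  ultimately have "g1 < r \<longleftrightarrow> 1 \<le> a" "g2 < r \<longleftrightarrow> 2 \<le> a" "g3 < r \<longleftrightarrow> 3 \<le> a" "g4 < r \<longleftrightarrow> 4 \<le> a"
    and a_w: "1 \<le> a \<longleftrightarrow> w \<le> 3" "2 \<le> a \<longleftrightarrow> w \<le> 2" "3 \<le> a \<longleftrightarrow> w \<le> 1" "4 \<le> a \<longleftrightarrow> w \<le> 0"
    using cmp[of g1] cmp[of g2] cmp[of g3] cmp[of g4] cas unfolding in_case_def by blast+
  then have count': "q = 1 + of_bool (1 \<le> a) + of_bool (2 \<le> a) + of_bool (3 \<le> a) + of_bool (4 \<le> a)"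
    using count by simp
  have sum4: "a + b + w = 4" using cas by (simp add: in_case_def)
  then consider "a = 0" | "a = 1" | "a = 2" | "a = 3" | "a = 4" by linarith
  then show ?thesis
    by cases (use count' a_w sum4 in simp_all)
qed

section \<open>Inequalities that exclude cases\<close>

text \<open>Divided by the product of the six moduli, the hypothesis on the coefficient of \<open>x\<close> reads
  \<open>1/g1 + 1/g2 + 1/g3 + 1/g4 < 1/\<beta> + 1/\<alpha>\<close>. But if \<open>g1 < \<beta>\<close> and \<open>g2 \<le> \<alpha>\<close>, then already
  \<open>1/g1 + 1/g2 > 1/\<beta> + 1/\<alpha>\<close>.\<close>

lemma second_modulus_bound:
  assumes adm: "admissible g1 g2 g3 g4 \<beta> \<alpha>"
    and c5: "descending_coeffs g1 g2 g3 g4 \<beta> \<alpha> ! 5 < 0"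
    and "g1 < \<beta>"
  shows "\<alpha> < g2"
proof (rule ccontr)
  have g: "0 < g1" "g1 < g2" "g2 < g3" "g3 < g4" "0 < \<beta>" "\<beta> < \<alpha>"
    using adm by (simp_all add: admissible_def)
  assume "\<not> \<alpha> < g2"
  \<comment> \<open>\<open>(1/g1 - 1/\<beta>) + (1/g2 - 1/\<alpha>)\<close> and \<open>1/g3 + 1/g4\<close>, both multiplied by \<open>\<alpha> \<beta> g1 g2 g3 g4\<close>\<close>
  then have "0 \<le> g3*g4*(\<alpha>*g2*(\<beta>-g1) + \<beta>*g1*(\<alpha>-g2)) + \<alpha>*\<beta>*g1*g2*(g3+g4)"
    using g \<open>g1 < \<beta>\<close> by simp
  also have "\<dots> = \<alpha> * \<beta> * (g1*g2*g3 + g1*g2*g4 + g1*g3*g4 + g2*g3*g4) - (\<alpha> + \<beta>) * (g1*g2*g3*g4)"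
    by (simp add: algebra_simps)
  finally show False using c5 by (simp add: nth_descending_coeffs)
qed

text \<open>Pairing the factors gives \<open>(x + g1)(x - \<beta>) = x^2 - d x - \<beta> g1\<close> and
  \<open>(x + g4)(x - \<alpha>) = x^2 - f x - \<alpha> g4\<close> with \<open>d, f \<ge> 0\<close> if \<open>\<alpha> \<ge> g4\<close>. The remaining factor is
  \<open>x^2 + u x + g2 g3\<close>, and positivity of the coefficient of \<open>x^5\<close> means \<open>d + f < u\<close>. Then
  the only positive contributions \<open>d f\<close> and \<open>g2 g3\<close> to the coefficient of \<open>x^4\<close> are outweighed by
  \<open>u (d + f)\<close> and \<open>\<alpha> g4\<close>.\<close>

lemma not_above_all_moduli:
  assumes adm: "admissible g1 g2 g3 g4 \<beta> \<alpha>"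
    and c1: "0 < descending_coeffs g1 g2 g3 g4 \<beta> \<alpha> ! 1"
    and c2: "0 < descending_coeffs g1 g2 g3 g4 \<beta> \<alpha> ! 2"
    and "g1 < \<beta>"
  shows "\<alpha> < g4"
proof (rule ccontr)
  have g: "0 < g1" "g1 < g2" "g2 < g3" "g3 < g4" "0 < \<beta>" "\<beta> < \<alpha>"
    using adm by (simp_all add: admissible_def)
  assume "\<not> \<alpha> < g4"
  define d f u where "d = \<beta> - g1" and "f = \<alpha> - g4" and "u = g2 + g3"
  have "d > 0" "f \<ge> 0" "d + f < u"
    using c1[unfolded nth_descending_coeffs] \<open>\<not> \<alpha> < g4\<close> \<open>g1 < \<beta>\<close>
    by (auto simp: d_def f_def u_def)
  have "d * f \<le> (d + f) * (d + f)"
    using \<open>d > 0\<close> \<open>f \<ge> 0\<close> by (intro mult_mono) auto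
  also have "\<dots> \<le> u * (d + f)"
    using \<open>d > 0\<close> \<open>f \<ge> 0\<close> \<open>d + f < u\<close> by (intro mult_right_mono) auto
  finally have df: "d * f \<le> u * (d + f)" .
  have "g2 * g3 < g4 * g4" using g by (intro mult_strict_mono) auto
  also have "\<dots> \<le> \<alpha> * g4" using g \<open>\<not> \<alpha> < g4\<close> by (intro mult_right_mono) auto
  finally have "g2 * g3 < \<alpha> * g4" .
  moreover have "0 < \<beta> * g1" using g \<open>g1 < \<beta>\<close> by simp
  moreover have "(g1*g2+g1*g3+g1*g4+g2*g3+g2*g4+g3*g4) - (\<alpha>+\<beta>)*(g1+g2+g3+g4) + \<alpha>*\<beta>
      = g2 * g3 - u * (d + f) + d * f - \<beta> * g1 - \<alpha> * g4"
    by (simp add: d_def f_def u_def algebra_simps)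
  ultimately show False using c2 df unfolding nth_descending_coeffs by linarith
qed

text \<open>The coefficient of \<open>x^3\<close> is affine in \<open>\<alpha>\<close> and in \<open>\<beta>\<close>. It decreases in \<open>\<alpha>\<close>, so it is largest
  at \<open>\<alpha> = g3\<close> on the range \<open>\<alpha> \<ge> g3\<close>; there it is affine in \<open>\<beta>\<close> and negative at both ends of
  \<open>0 \<le> \<beta> \<le> g1\<close>. In the proof \<open>e1, e2, e3\<close> are the elementary symmetric functions of
  \<open>g1, g2, g4\<close>.\<close>

lemma below_third_modulus:
  assumes adm: "admissible g1 g2 g3 g4 \<beta> \<alpha>"
    and c3: "0 < descending_coeffs g1 g2 g3 g4 \<beta> \<alpha> ! 3"
    and "\<beta> < g1"
  shows "\<alpha> < g3"
proof (rule ccontr)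
  have g: "0 < g1" "g1 < g2" "g2 < g3" "g3 < g4" "0 < \<beta>" "\<beta> < \<alpha>"
    using adm by (simp_all add: admissible_def)
  assume "\<not> \<alpha> < g3"
  define e1 e2 e3 where "e1 = g1+g2+g4" and "e2 = g1*g2+g1*g4+g2*g4" and "e3 = g1*g2*g4"
  have "\<beta> * (e1 + g3) \<le> g1 * (e1 + g3)"
    using g \<open>\<beta> < g1\<close> by (intro mult_right_mono) (auto simp: e1_def)
  also have "\<dots> \<le> e2 + g3 * e1"
  proof -
    have "g1 * g1 < g2 * g3" using g by (intro mult_strict_mono) auto
    moreover have "0 < g2 * g4" "0 < g3 * g4" using g by simp_all
    ultimately show ?thesis unfolding e1_def e2_def by (simp add: algebra_simps)
  qed
  finally have "0 \<le> (\<alpha> - g3) * ((e2 + g3 * e1) - \<beta> * (e1 + g3))"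
    using \<open>\<not> \<alpha> < g3\<close> by simp
  moreover have p: "g1*g2 < g3*g3"
    using g by (intro mult_strict_mono) auto
  have at_0: "e3 - g3\<^sup>2 * e1 < 0"
  proof -
    have "g1*g2*g4 < g3*g3*g4" "0 < g3*g3*g1" "0 < g3*g3*g2" using p g by simp_all
    then show ?thesis by (simp add: e1_def e3_def algebra_simps power2_eq_square)
  qed
  have at_g1: "e3 - g3\<^sup>2 * e1 - g1 * e2 + g1 * g3\<^sup>2 < 0"
  proof -
    have "g1*g2*g4 < g3*g3*g4" using p g by simp
    moreover have "0 < g3*g3*g2" "0 < g1*(g1*g2 + g1*g4 + g2*g4)" using g by (simp_all add: add_pos_pos)
    ultimately show ?thesis by (simp add: e1_def e2_def e3_def algebra_simps power2_eq_square)
  qed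
  have "(g1 - \<beta>) * (e3 - g3\<^sup>2 * e1) + \<beta> * (e3 - g3\<^sup>2 * e1 - g1 * e2 + g1 * g3\<^sup>2) < 0"
    using at_0 at_g1 g(5) \<open>\<beta> < g1\<close>
    by (intro add_neg_neg[OF mult_pos_neg mult_pos_neg]) simp_all
  then have "g1 * (e3 - g3\<^sup>2 * e1 - \<beta> * (e2 - g3\<^sup>2)) < 0"
    by (simp add: algebra_simps)
  then have "e3 - g3\<^sup>2 * e1 - \<beta> * (e2 - g3\<^sup>2) < 0"
    using g by (simp add: mult_less_0_iff)
  moreover have "(g1*g2*g3 + g1*g2*g4 + g1*g3*g4 + g2*g3*g4)
      - (\<alpha>+\<beta>)*(g1*g2+g1*g3+g1*g4+g2*g3+g2*g4+g3*g4) + \<alpha>*\<beta>*(g1+g2+g3+g4)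
      = (e3 - g3\<^sup>2 * e1 - \<beta> * (e2 - g3\<^sup>2)) - (\<alpha> - g3) * ((e2 + g3 * e1) - \<beta> * (e1 + g3))"
    by (simp add: e1_def e2_def e3_def algebra_simps power2_eq_square)
  ultimately show False using c3 unfolding nth_descending_coeffs by linarith
qed

text \<open>With \<open>s = \<alpha> + \<beta>\<close> and \<open>t = \<alpha> \<beta>\<close> all conditions are linear in \<open>(s, t)\<close>, also the consequence
  \<open>g2^2 - s g2 + t \<ge> 0\<close> of \<open>\<alpha> \<le> g2\<close>. Eliminating \<open>t\<close> bounds \<open>s - g2\<close> from above by \<open>e3/e2\<close> and
  from below by \<open>(e2 - g2^2)/e1\<close>, where \<open>e1, e2, e3\<close> are the elementary symmetric functions of
  \<open>g1, g3, g4\<close>. These bounds contradict each other.\<close>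

lemma above_second_modulus:
  assumes adm: "admissible g1 g2 g3 g4 \<beta> \<alpha>"
    and c2: "descending_coeffs g1 g2 g3 g4 \<beta> \<alpha> ! 2 < 0"
    and c5: "descending_coeffs g1 g2 g3 g4 \<beta> \<alpha> ! 5 < 0"
  shows "g2 < \<alpha>"
proof (rule ccontr)
  have g: "0 < g1" "g1 < g2" "g2 < g3" "g3 < g4" "0 < \<beta>" "\<beta> < \<alpha>"
    using adm by (simp_all add: admissible_def)
  assume "\<not> g2 < \<alpha>"
  define e1 e2 e3 s where "e1 = g1+g3+g4" and "e2 = g1*g3+g1*g4+g3*g4" and "e3 = g1*g3*g4"
    and "s = \<alpha> + \<beta>"
  have e: "e1 > 0" "e2 > 0" "e3 > 0" using g by (auto simp: e1_def e2_def e3_def add_pos_pos)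
  have "0 \<le> (g2 - \<alpha>) * (g2 - \<beta>)" using \<open>\<not> g2 < \<alpha>\<close> g(6) by simp
  then have q: "g2 * (s - g2) \<le> \<alpha> * \<beta>" by (simp add: s_def algebra_simps)
  have "g2 * (s - g2) * (g2 * e2 + e3) \<le> \<alpha> * \<beta> * (g2 * e2 + e3)"
    using q e g by (intro mult_right_mono) auto
  also have "\<dots> < s * (g2 * e3)"
    using c5 by (simp add: nth_descending_coeffs e1_def e2_def e3_def s_def algebra_simps)
  finally have "g2 * (g2 * ((s - g2) * e2 - e3)) < 0"
    by (simp add: algebra_simps)
  then have up: "(s - g2) * e2 < e3" using g by (simp add: mult_less_0_iff)
  have lo: "e2 - g2\<^sup>2 < (s - g2) * e1"
    using c2 q by (simp add: nth_descending_coeffs e1_def e2_def s_def algebra_simps power2_eq_square)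
  have "e2 * (e2 - g2\<^sup>2) < e2 * ((s - g2) * e1)" using lo e by simp
  also have "\<dots> = e1 * ((s - g2) * e2)" by simp
  also have "\<dots> < e1 * e3" using up e by simp
  finally have "e2 * (e2 - g2\<^sup>2) < e1 * e3" .
  moreover have "e1 * e3 \<le> e2 * (e2 - g2\<^sup>2)"
  proof -
    have "g2*g2 \<le> g3*g4" using g by (intro mult_mono) auto
    from mult_right_mono[OF this, of "g3*g4"] mult_right_mono[OF this, of "g1*g3"]
      mult_right_mono[OF this, of "g1*g4"]
    have "g2*g2*(g3*g4) \<le> g3*g4*(g3*g4)" "g2*g2*(g1*g3) \<le> g3*g4*(g1*g3)"
      "g2*g2*(g1*g4) \<le> g3*g4*(g1*g4)" using g by simp_all
    moreover have "0 \<le> (g1*g3)*(g1*g3) + (g1*g4)*(g1*g4) + g1*g1*g3*g4" using g by simp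
    ultimately show ?thesis
      by (simp add: e1_def e2_def e3_def algebra_simps power2_eq_square)
  qed
  ultimately show False by simp
qed

section \<open>Realizable cases\<close>

lemma realizable_sum: "realizable m n q (a, b, w) \<Longrightarrow> a + b + w = 4"
  by (erule realizableE) (simp add: in_case_def)

text \<open>If \<open>a \<ge> 1\<close>, then \<open>\<alpha> < g2\<close> means that at least three of the \<open>g\<close>'s exceed \<open>\<alpha>\<close>, and
  \<open>a + b + w = 4\<close> leaves no choice.\<close>

lemma realizable_q_1D:
  assumes "realizable m n 1 (a, b, w)" "n \<ge> 1"
  shows "a = 0 \<or> (a, b, w) = (1, 0, 3)"
proof -
  obtain g1 g2 g3 g4 \<beta> \<alpha> where adm: "admissible g1 g2 g3 g4 \<beta> \<alpha>"
    and cas: "in_case g1 g2 g3 g4 \<beta> \<alpha> a b w"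
    and signs: "map sgn (descending_coeffs g1 g2 g3 g4 \<beta> \<alpha>) = Sigma_pattern m n 1"
    using realizableE[OF assms(1)] by blast
  have "m + n + 1 = 7"
    using arg_cong[OF signs, of length] by (simp add: descending_coeffs_def Sigma_pattern_def)
  then have c5: "descending_coeffs g1 g2 g3 g4 \<beta> \<alpha> ! 5 < 0"
    using descending_coeffs_sign(2)[OF signs, of 5] \<open>n \<ge> 1\<close> by simp
  have "\<not> w \<le> 2" if "1 \<le> a"
  proof -
    have "g1 < \<beta>" using cas that by (simp add: in_case_def)
    then have "\<alpha> < g2" by (rule second_modulus_bound[OF adm c5])
    then show ?thesis using cas by (auto simp: in_case_def)
  qed
  then show ?thesis using realizable_sum[OF assms(1)] by auto
qed

lemma realizable_2_4_1D:
  assumes "realizable 2 4 1 (a, b, w)"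
  shows "w \<le> 2"
proof -
  obtain g1 g2 g3 g4 \<beta> \<alpha> where adm: "admissible g1 g2 g3 g4 \<beta> \<alpha>"
    and cas: "in_case g1 g2 g3 g4 \<beta> \<alpha> a b w"
    and signs: "map sgn (descending_coeffs g1 g2 g3 g4 \<beta> \<alpha>) = Sigma_pattern 2 4 1"
    using realizableE[OF assms] by blast
  have "g2 < \<alpha>"
    by (rule above_second_modulus[OF adm]; rule descending_coeffs_sign(2)[OF signs]) simp_all
  then show ?thesis using cas by (simp add: in_case_def)
qed

lemma realizable_4_2_1D:
  assumes "realizable 4 2 1 (a, b, w)" "a = 0"
  shows "w \<ge> 2"
proof -
  obtain g1 g2 g3 g4 \<beta> \<alpha> where adm: "admissible g1 g2 g3 g4 \<beta> \<alpha>"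
    and cas: "in_case g1 g2 g3 g4 \<beta> \<alpha> a b w"
    and signs: "map sgn (descending_coeffs g1 g2 g3 g4 \<beta> \<alpha>) = Sigma_pattern 4 2 1"
    using realizableE[OF assms(1)] by blast
  have "\<not> g1 < \<beta>" using cas \<open>a = 0\<close> by (simp add: in_case_def)
  then have "\<beta> < g1" using adm by (auto simp: admissible_def)
  have "0 < descending_coeffs g1 g2 g3 g4 \<beta> \<alpha> ! 3"
    by (rule descending_coeffs_sign(1)[OF signs]) simp_all
  then have "\<alpha> < g3" by (rule below_third_modulus[OF adm _ \<open>\<beta> < g1\<close>])
  then have "\<not> w \<le> 1" using cas by (auto simp: in_case_def)
  then show ?thesis by simp
qed

lemma realizable_3_2_2D:
  assumes "realizable 3 2 2 (a, b, w)" "a \<ge> 1"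
  shows "w \<noteq> 0"
proof -
  obtain g1 g2 g3 g4 \<beta> \<alpha> where adm: "admissible g1 g2 g3 g4 \<beta> \<alpha>"
    and cas: "in_case g1 g2 g3 g4 \<beta> \<alpha> a b w"
    and signs: "map sgn (descending_coeffs g1 g2 g3 g4 \<beta> \<alpha>) = Sigma_pattern 3 2 2"
    using realizableE[OF assms(1)] by blast
  have "g1 < \<beta>" using cas \<open>a \<ge> 1\<close> by (simp add: in_case_def)
  moreover have "0 < descending_coeffs g1 g2 g3 g4 \<beta> \<alpha> ! 1" "0 < descending_coeffs g1 g2 g3 g4 \<beta> \<alpha> ! 2"
    by (rule descending_coeffs_sign(1)[OF signs]; simp)+
  ultimately have "\<alpha> < g4" using not_above_all_moduli[OF adm] by blast
  then show ?thesis using cas by (auto simp: in_case_def)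
qed

lemma realizable_m_1_qD:
  assumes "realizable m 1 q (a, b, w)"
  shows "a + 1 = q \<and> b = 0"
  by (rule realizableE[OF assms]) (rule one_negative_coeff)

lemma replicate_numeral_eq: "replicate (numeral k) x = x # replicate (pred_numeral k) x"
  by (simp add: numeral_eq_Suc)

lemmas witness_simps =
  admissible_def in_case_def descending_coeffs_def Sigma_pattern_def replicate_numeral_eq

text \<open>Each witness lists the four moduli of the negative roots, then \<open>\<beta>\<close>, then \<open>\<alpha>\<close>.\<close>

lemma witnesses_1_1_5: "realizable 1 1 5 (4, 0, 0)"
  by (rule realizableI[of 1 2 3 4 18 19]) (simp_all add: witness_simps)

lemma witnesses_2_1_4: "realizable 2 1 4 (3, 0, 1)"
  by (rule realizableI[of 1 2 3 12 8 9]) (simp_all add: witness_simps)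

lemma witnesses_3_1_3: "realizable 3 1 3 (2, 0, 2)"
  by (rule realizableI[of 1 2 12 13 4 5]) (simp_all add: witness_simps)

lemma witnesses_4_1_2: "realizable 4 1 2 (1, 0, 3)"
  by (rule realizableI[of 1 11 12 13 2 3]) (simp_all add: witness_simps)

lemma witnesses_5_1_1: "realizable 5 1 1 (0, 0, 4)"
  by (rule realizableI[of 10 11 12 13 1 2]) (simp_all add: witness_simps)

lemma witnesses_1_5_1: "realizable 1 5 1 (0, 4, 0)"
  by (rule realizableI[of 3 4 5 6 1 18]) (simp_all add: witness_simps)

lemma witnesses_2_4_1:
  shows "realizable 2 4 1 (0, 2, 2)"
    and "realizable 2 4 1 (0, 3, 1)"
    and "realizable 2 4 1 (0, 4, 0)"
proof -
  show "realizable 2 4 1 (0, 2, 2)"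
    by (rule realizableI[of 2 3 8 9 1 7]) (simp_all add: witness_simps)
  show "realizable 2 4 1 (0, 3, 1)"
    by (rule realizableI[of 2 4 5 7 1 6]) (simp_all add: witness_simps)
  show "realizable 2 4 1 (0, 4, 0)"
    by (rule realizableI[of 3 4 5 6 1 7]) (simp_all add: witness_simps)
qed

lemma witnesses_3_3_1:
  shows "realizable 3 3 1 (0, 0, 4)"
    and "realizable 3 3 1 (0, 1, 3)"
    and "realizable 3 3 1 (0, 2, 2)"
    and "realizable 3 3 1 (0, 3, 1)"
    and "realizable 3 3 1 (0, 4, 0)"
    and "realizable 3 3 1 (1, 0, 3)"
proof -
  show "realizable 3 3 1 (0, 0, 4)"
    by (rule realizableI[of 4 5 6 7 2 3]) (simp_all add: witness_simps)
  show "realizable 3 3 1 (0, 1, 3)"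
    by (rule realizableI[of 2 4 5 6 1 3]) (simp_all add: witness_simps)
  show "realizable 3 3 1 (0, 2, 2)"
    by (rule realizableI[of 2 3 5 6 1 4]) (simp_all add: witness_simps)
  show "realizable 3 3 1 (0, 3, 1)"
    by (rule realizableI[of 3 4 5 7 1 6]) (simp_all add: witness_simps)
  show "realizable 3 3 1 (0, 4, 0)"
    by (rule realizableI[of 5 7 8 9 1 10]) (simp_all add: witness_simps)
  show "realizable 3 3 1 (1, 0, 3)"
    by (rule realizableI[of 8 31 36 45 9 10]) (simp_all add: witness_simps)
qed

lemma witnesses_4_2_1:
  shows "realizable 4 2 1 (0, 0, 4)"
    and "realizable 4 2 1 (0, 1, 3)"
    and "realizable 4 2 1 (0, 2, 2)"
    and "realizable 4 2 1 (1, 0, 3)"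
proof -
  show "realizable 4 2 1 (0, 0, 4)"
    by (rule realizableI[of 3 4 5 6 1 2]) (simp_all add: witness_simps)
  show "realizable 4 2 1 (0, 1, 3)"
    by (rule realizableI[of 2 7 8 9 1 3]) (simp_all add: witness_simps)
  show "realizable 4 2 1 (0, 2, 2)"
    by (rule realizableI[of 4 5 45 46 1 6]) (simp_all add: witness_simps)
  show "realizable 4 2 1 (1, 0, 3)"
    by (rule realizableI[of 3 24 25 29 4 5]) (simp_all add: witness_simps)
qed

lemma witnesses_2_3_2:
  shows "realizable 2 3 2 (0, 0, 4)"
    and "realizable 2 3 2 (0, 1, 3)"
    and "realizable 2 3 2 (0, 2, 2)"
    and "realizable 2 3 2 (0, 3, 1)"
    and "realizable 2 3 2 (0, 4, 0)"
    and "realizable 2 3 2 (1, 0, 3)"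
    and "realizable 2 3 2 (1, 1, 2)"
    and "realizable 2 3 2 (1, 2, 1)"
    and "realizable 2 3 2 (1, 3, 0)"
    and "realizable 2 3 2 (2, 0, 2)"
    and "realizable 2 3 2 (2, 1, 1)"
    and "realizable 2 3 2 (2, 2, 0)"
    and "realizable 2 3 2 (3, 0, 1)"
    and "realizable 2 3 2 (3, 1, 0)"
    and "realizable 2 3 2 (4, 0, 0)"
proof -
  show "realizable 2 3 2 (0, 0, 4)"
    by (rule realizableI[of 24 25 26 27 21 23]) (simp_all add: witness_simps)
  show "realizable 2 3 2 (0, 1, 3)"
    by (rule realizableI[of 12 15 16 17 11 14]) (simp_all add: witness_simps)
  show "realizable 2 3 2 (0, 2, 2)"
    by (rule realizableI[of 4 5 9 10 3 8]) (simp_all add: witness_simps)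
  show "realizable 2 3 2 (0, 3, 1)"
    by (rule realizableI[of 2 3 4 6 1 5]) (simp_all add: witness_simps)
  show "realizable 2 3 2 (0, 4, 0)"
    by (rule realizableI[of 2 3 4 5 1 6]) (simp_all add: witness_simps)
  show "realizable 2 3 2 (1, 0, 3)"
    by (rule realizableI[of 1 6 7 8 4 5]) (simp_all add: witness_simps)
  show "realizable 2 3 2 (1, 1, 2)"
    by (rule realizableI[of 1 3 5 6 2 4]) (simp_all add: witness_simps)
  show "realizable 2 3 2 (1, 2, 1)"
    by (rule realizableI[of 1 3 4 6 2 5]) (simp_all add: witness_simps)
  show "realizable 2 3 2 (1, 3, 0)"
    by (rule realizableI[of 1 3 4 5 2 6]) (simp_all add: witness_simps)
  show "realizable 2 3 2 (2, 0, 2)"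
    by (rule realizableI[of 2 3 6 7 4 5]) (simp_all add: witness_simps)
  show "realizable 2 3 2 (2, 1, 1)"
    by (rule realizableI[of 4 5 7 9 6 8]) (simp_all add: witness_simps)
  show "realizable 2 3 2 (2, 2, 0)"
    by (rule realizableI[of 5 6 9 10 7 11]) (simp_all add: witness_simps)
  show "realizable 2 3 2 (3, 0, 1)"
    by (rule realizableI[of 6 7 8 13 9 10]) (simp_all add: witness_simps)
  show "realizable 2 3 2 (3, 1, 0)"
    by (rule realizableI[of 11 12 13 15 14 16]) (simp_all add: witness_simps)
  show "realizable 2 3 2 (4, 0, 0)"
    by (rule realizableI[of 21 22 23 25 26 27]) (simp_all add: witness_simps)
qed

lemma witnesses_3_2_2:
  shows "realizable 3 2 2 (0, 0, 4)"
    and "realizable 3 2 2 (0, 1, 3)"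
    and "realizable 3 2 2 (0, 2, 2)"
    and "realizable 3 2 2 (0, 3, 1)"
    and "realizable 3 2 2 (0, 4, 0)"
    and "realizable 3 2 2 (1, 0, 3)"
    and "realizable 3 2 2 (1, 1, 2)"
    and "realizable 3 2 2 (1, 2, 1)"
    and "realizable 3 2 2 (2, 0, 2)"
    and "realizable 3 2 2 (2, 1, 1)"
    and "realizable 3 2 2 (3, 0, 1)"
proof -
  show "realizable 3 2 2 (0, 0, 4)"
    by (rule realizableI[of 5 6 7 8 3 4]) (simp_all add: witness_simps)
  show "realizable 3 2 2 (0, 1, 3)"
    by (rule realizableI[of 3 5 6 7 2 4]) (simp_all add: witness_simps)
  show "realizable 3 2 2 (0, 2, 2)"
    by (rule realizableI[of 3 4 6 7 2 5]) (simp_all add: witness_simps)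
  show "realizable 3 2 2 (0, 3, 1)"
    by (rule realizableI[of 4 5 6 8 2 7]) (simp_all add: witness_simps)
  show "realizable 3 2 2 (0, 4, 0)"
    by (rule realizableI[of 8 9 10 11 3 12]) (simp_all add: witness_simps)
  show "realizable 3 2 2 (1, 0, 3)"
    by (rule realizableI[of 1 4 5 6 2 3]) (simp_all add: witness_simps)
  show "realizable 3 2 2 (1, 1, 2)"
    by (rule realizableI[of 1 3 6 7 2 4]) (simp_all add: witness_simps)
  show "realizable 3 2 2 (1, 2, 1)"
    by (rule realizableI[of 1 6 7 18 2 8]) (simp_all add: witness_simps)
  show "realizable 3 2 2 (2, 0, 2)"
    by (rule realizableI[of 1 2 8 10 3 4]) (simp_all add: witness_simps)
  show "realizable 3 2 2 (2, 1, 1)"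
    by (rule realizableI[of 13 14 16 54 15 17]) (simp_all add: witness_simps)
  show "realizable 3 2 2 (3, 0, 1)"
    by (rule realizableI[of 25 29 30 125 31 34]) (simp_all add: witness_simps)
qed

lemma sum_eq_4_cases:
  fixes a b w :: nat
  assumes "a + b + w = 4"
  shows "(a, b, w) \<in> {(0,0,4), (0,1,3), (0,2,2), (0,3,1), (0,4,0), (1,0,3), (1,1,2), (1,2,1), (1,3,0),
    (2,0,2), (2,1,1), (2,2,0), (3,0,1), (3,1,0), (4,0,0)}"
proof -
  have "w = 4 - a - b" "a + b \<le> 4" using assms by simp_all
  have "a = 0 \<or> a = 1 \<or> a = 2 \<or> a = 3 \<or> a = 4" "b = 0 \<or> b = 1 \<or> b = 2 \<or> b = 3 \<or> b = 4"
    using \<open>a + b \<le> 4\<close> by linarith+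
  then show ?thesis
    using \<open>a + b \<le> 4\<close> unfolding \<open>w = 4 - a - b\<close> by (elim disjE) simp_all
qed

lemma realizable_cases_eqI:
  assumes "\<And>a b w. realizable m n q (a, b, w) \<Longrightarrow> (a, b, w) \<in> S"
    and "\<And>a b w. (a, b, w) \<in> S \<Longrightarrow> realizable m n q (a, b, w)"
  shows "realizable_cases m n q = S"
proof (rule set_eqI)
  fix c :: "nat \<times> nat \<times> nat"
  obtain a b w where "c = (a, b, w)" by (cases c)
  then show "c \<in> realizable_cases m n q \<longleftrightarrow> c \<in> S"
    unfolding realizable_cases_def mem_Collect_eq using assms by blast
qed

lemma cases_1_5_1: "realizable_cases 1 5 1 = {(0,4,0)}"
proof (rule realizable_cases_eqI)
  show "(a, b, w) \<in> {(0,4,0)}" if r: "realizable 1 5 1 (a, b, w)" for a b w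
  proof -
    have "a = 0 \<or> (a, b, w) = (1, 0, 3)"
      by (rule realizable_q_1D[OF r]) simp
    moreover have "w = 0 \<or> (w, b, a) = (1, 0, 3)"
      by (rule realizable_q_1D[OF realizable_reversion[OF r]]) simp
    ultimately show ?thesis using realizable_sum[OF r] by (elim disjE) simp_all
  qed
  show "realizable 1 5 1 (a, b, w)" if "(a, b, w) \<in> {(0,4,0)}" for a b w
    using that witnesses_1_5_1 by simp
qed

lemma cases_m_1_q:
  assumes "m \<ge> 1" "q \<ge> 1" "m + q = 6"
  shows "realizable_cases m 1 q = {(q - 1, 0, m - 1)}"
proof (rule realizable_cases_eqI)
  show "(a, b, w) \<in> {(q - 1, 0, m - 1)}" if "realizable m 1 q (a, b, w)" for a b w
    using realizable_m_1_qD[OF that] realizable_sum[OF that] assms by auto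
  have "realizable m 1 q (q - 1, 0, m - 1)"
  proof -
    consider "m = 1" "q = 5" | "m = 2" "q = 4" | "m = 3" "q = 3" | "m = 4" "q = 2" | "m = 5" "q = 1"
      using assms by linarith
    then show ?thesis
      by cases (use witnesses_1_1_5 witnesses_2_1_4 witnesses_3_1_3 witnesses_4_1_2 witnesses_5_1_1
        in simp_all)
  qed
  then show "realizable m 1 q (a, b, w)" if "(a, b, w) \<in> {(q - 1, 0, m - 1)}" for a b w
    using that by simp
qed

lemma cases_2_4_1: "realizable_cases 2 4 1 = {(0,2,2), (0,3,1), (0,4,0)}"
proof (rule realizable_cases_eqI)
  show "(a, b, w) \<in> {(0,2,2), (0,3,1), (0,4,0)}" if "realizable 2 4 1 (a, b, w)" for a b w
    using realizable_q_1D[OF that] realizable_2_4_1D[OF that]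
      sum_eq_4_cases[OF realizable_sum[OF that]] by auto
  show "realizable 2 4 1 (a, b, w)" if "(a, b, w) \<in> {(0,2,2), (0,3,1), (0,4,0)}" for a b w
    using that witnesses_2_4_1 by auto
qed

lemma cases_3_3_1: "realizable_cases 3 3 1 = {(1,0,3), (0,0,4), (0,1,3), (0,2,2), (0,3,1), (0,4,0)}"
proof (rule realizable_cases_eqI)
  show "(a, b, w) \<in> {(1,0,3), (0,0,4), (0,1,3), (0,2,2), (0,3,1), (0,4,0)}" if "realizable 3 3 1 (a, b, w)" for a b w
    using realizable_q_1D[OF that]
      sum_eq_4_cases[OF realizable_sum[OF that]] by auto
  show "realizable 3 3 1 (a, b, w)" if "(a, b, w) \<in> {(1,0,3), (0,0,4), (0,1,3), (0,2,2), (0,3,1), (0,4,0)}" for a b w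
    using that witnesses_3_3_1 by auto
qed

lemma cases_4_2_1: "realizable_cases 4 2 1 = {(1,0,3), (0,0,4), (0,1,3), (0,2,2)}"
proof (rule realizable_cases_eqI)
  show "(a, b, w) \<in> {(1,0,3), (0,0,4), (0,1,3), (0,2,2)}" if "realizable 4 2 1 (a, b, w)" for a b w
    using realizable_q_1D[OF that] realizable_4_2_1D[OF that]
      sum_eq_4_cases[OF realizable_sum[OF that]] by auto
  show "realizable 4 2 1 (a, b, w)" if "(a, b, w) \<in> {(1,0,3), (0,0,4), (0,1,3), (0,2,2)}" for a b w
    using that witnesses_4_2_1 by auto
qed

lemma cases_2_3_2: "realizable_cases 2 3 2 = {(a,b,w). a + b + w = 4}"
proof (rule realizable_cases_eqI)
  show "(a, b, w) \<in> {(a,b,w). a + b + w = 4}" if "realizable 2 3 2 (a, b, w)" for a b w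
    using realizable_sum[OF that] by simp
  show "realizable 2 3 2 (a, b, w)" if "(a, b, w) \<in> {(a,b,w). a + b + w = 4}" for a b w
    using sum_eq_4_cases[of a b w] that witnesses_2_3_2 by auto
qed

lemma cases_3_2_2:
  "realizable_cases 3 2 2 = {(a,b,w). a + b + w = 4} - {(4,0,0), (3,1,0), (2,2,0), (1,3,0)}"
proof (rule realizable_cases_eqI)
  show "(a, b, w) \<in> {(a,b,w). a + b + w = 4} - {(4,0,0), (3,1,0), (2,2,0), (1,3,0)}"
    if "realizable 3 2 2 (a, b, w)" for a b w
    using realizable_3_2_2D[OF that] realizable_sum[OF that] by auto
  show "realizable 3 2 2 (a, b, w)"
    if "(a, b, w) \<in> {(a,b,w). a + b + w = 4} - {(4,0,0), (3,1,0), (2,2,0), (1,3,0)}" for a b w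
    using sum_eq_4_cases[of a b w] that witnesses_3_2_2 by auto
qed

theorem mainTheorem1:
  shows "realizable_cases 1 5 1 = {(0,4,0)} \<and>
    (\<forall>m q. m \<ge> 1 \<and> q \<ge> 1 \<and> m + q = 6 \<longrightarrow>
       realizable_cases m 1 q = {(q - 1, 0, m - 1)}) \<and>
    realizable_cases 2 4 1 = {(0,2,2), (0,3,1), (0,4,0)} \<and>
    realizable_cases 3 3 1 = {(1,0,3), (0,0,4), (0,1,3), (0,2,2), (0,3,1), (0,4,0)} \<and>
    realizable_cases 4 2 1 = {(1,0,3), (0,0,4), (0,1,3), (0,2,2)} \<and>
    realizable_cases 2 3 2 = {(a,b,w). a + b + w = 4} \<and>
    realizable_cases 3 2 2 =
      {(a,b,w). a + b + w = 4} - {(4,0,0), (3,1,0), (2,2,0), (1,3,0)} \<and>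
    (\<forall>m n q a b w. m \<ge> 1 \<and> n \<ge> 1 \<and> q \<ge> 1 \<and> m + n + q = 7 \<and> a + b + w = 4 \<longrightarrow>
       (realizable m n q (a, b, w) \<longleftrightarrow> realizable q n m (w, b, a)))"
proof (intro conjI)
  show "\<forall>m q. m \<ge> 1 \<and> q \<ge> 1 \<and> m + q = 6 \<longrightarrow> realizable_cases m 1 q = {(q - 1, 0, m - 1)}"
    using cases_m_1_q by blast
  show "\<forall>m n q a b w. m \<ge> 1 \<and> n \<ge> 1 \<and> q \<ge> 1 \<and> m + n + q = 7 \<and> a + b + w = 4 \<longrightarrow>
      (realizable m n q (a, b, w) \<longleftrightarrow> realizable q n m (w, b, a))"
    using realizable_reversion by blast
qed (rule cases_1_5_1 cases_2_4_1 cases_3_3_1 cases_4_2_1 cases_2_3_2 cases_3_2_2)+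

end
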